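(* Let $\mathcal X$ be a Banach space, $F:\mathcal D(F)\subset\mathcal X\to L^1(\mathbb M)$ an operator, $\mathcal R:\mathcal X\to(-\infty,\infty]$ convex and lower semicontinuous, $f^\dagger\in\mathcal D(F)$ and $g^\dagger=F(f^\dagger)$. Assume: (i) (variational source condition) there are $\beta>0$ and a concave, increasing $\varphi:[0,\infty)\to[0,\infty)$ with $\varphi(0)=0$ such that $$\beta\,\mathcal D(f,f^\dagger)\le \mathcal R(f)-\mathcal R(f^\dagger)+\varphi\big(\|F(f)-F(f^\dagger)\|_{L^1(\mathbb M)}\big)\qquad\text{for all } f\in\mathcal D(F)$$ (actually this is only needed for $f=\hat f_\alpha$, with $\hat f_\alpha$ as below); (ii) (smoothing property) there are $\delta_0>0$, $q>1$ and an increasing $\gamma:[0,\delta_0]\to[0,\infty)$ with $\lim_{\delta\to0}\gamma(\delta)=0$ such that $$\|F(f)-g^\dagger\|_{L^\infty(\mathbb M)}\le\gamma(\delta)\,\mathcal D(f,f^\dagger)^{1/q}+\frac1\delta\|F(f)-g^\dagger\|_{L^1(\mathbb M)}\qquad\text{for all }0<\delta\le\delta_0,\ f\in\mathcal D(F).$$ Let $q'$ be the conjugate index, $\frac1q+\frac1{q'}=1$, and $\psi(\alpha):=\sup_{\tau\ge0}\big(\varphi(\tau)-\frac{\tau}{\alpha}\big)$ for $\alpha>0$. Then for every $b>1$ there exists $\eta_0>0$ such that for all $0<\eta\le\eta_0$, $\epsilon\ge0$, $\alpha>0$, all data $g^{\rm obs}=g^\dagger+\xi\in L^1(\mathbb M)$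 whose noise $\xi$ satisfies $$\exists\ \mathbb P\subset\mathbb M\text{ Borel}:\quad \|\xi\|_{L^1(\mathbb M\setminus\mathbb P)}\le\epsilon,\quad |\mathbb P|\le\eta,$$ and every minimizer $$\hat f_\alpha\in\operatorname*{argmin}_{f\in\mathcal D(F)}\Big[\tfrac1\alpha\|F(f)-g^{\rm obs}\|_{L^1(\mathbb M)}+\mathcal R(f)\Big],$$ one has $$\beta\,\mathcal D(\hat f_\alpha,f^\dagger)\le\frac{2q'}{\alpha}\epsilon+\beta^{1-q'}\Big(\frac2\alpha\,\eta\,\gamma\big(\tfrac{2b}{b-1}\eta\big)\Big)^{q'}+q'\,\psi(b\alpha),$$ $$\frac1b\|F(\hat f_\alpha)-g^\dagger\|_{L^1(\mathbb M)}\le4q'\epsilon+2\,\frac{\big(2\eta\,\gamma(\frac{2b}{b-1}\eta)\big)^{q'}}{(\beta\alpha)^{q'-1}}+2\alpha q'\,\psi(2b\alpha).$$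
   Context: $\mathbb M\subset\mathbb R^d$ is a submanifold with its natural measure $|\cdot|$; the spaces $L^p(\mathbb M)$ are taken with respect to this measure. $f^\dagger$ is the exact solution and $g^\dagger=F(f^\dagger)$ the exact data; $\mathcal R(f^\dagger)<\infty$ and a subgradient $f^*\in\partial\mathcal R(f^\dagger)$ is fixed. The Bregman distance is $\mathcal D(f,f^\dagger):=\mathcal R(f)-\mathcal R(f^\dagger)-\langle f^*,f-f^\dagger\rangle\ge 0$. The function $\psi$ may take the value $+\infty$. *)

theory Defs
  imports "HOL-Probability.Essential_Supremum"
begin

section \<open>Embedded submanifolds and their natural measure\<close>

definition C1_on :: "('a::real_normed_vector \<Rightarrow> 'b::real_normed_vector) \<Rightarrow> 'a set \<Rightarrow> bool" where
  "C1_on f U \<longleftrightarrow>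
     (\<exists>f' :: 'a \<Rightarrow> 'a \<Rightarrow>\<^sub>L 'b.
        (\<forall>x\<in>U. (f has_derivative blinfun_apply (f' x)) (at x)) \<and> continuous_on U f')"

text \<open>Embedded \<open>k\<close>-dimensional \<open>C\<^sup>1\<close> submanifolds without boundary: locally, an ambient
  \<open>C\<^sup>1\<close> diffeomorphism flattens \<open>M\<close> to (an open part of) a \<open>k\<close>-dimensional linear subspace.
  Being \<open>C\<^sup>1\<close> is the least regularity for which the Riemannian volume is defined, so all
  smooth submanifolds are included.\<close>

definition submanifold :: "nat \<Rightarrow> 'a::euclidean_space set \<Rightarrow> bool" where
  "submanifold k M \<longleftrightarrow>
     (\<forall>p\<in>M. \<exists>(U :: 'a set) (V :: 'a set) (S :: 'a set) (\<Phi> :: 'a \<Rightarrow> 'a) (\<Psi> :: 'a \<Rightarrow> 'a).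
        open U \<and> p \<in> U \<and> open V \<and> homeomorphism U V \<Phi> \<Psi> \<and> C1_on \<Phi> U \<and> C1_on \<Psi> V \<and>
        subspace S \<and> dim S = k \<and> \<Phi> ` (M \<inter> U) = S \<inter> V)"

text \<open>Hausdorff measure, normalised so that it agrees with the Riemannian volume on
  \<open>k\<close>-dimensional submanifolds. The case distinction is needed for \<open>k = 0\<close>, where
  \<open>0 ^ 0 = 1\<close>; boundedness of the covering sets is required because the library's diameter
  is unspecified for unbounded sets.\<close>

definition hausdorff_weight :: "nat \<Rightarrow> 'a::metric_space set \<Rightarrow> ennreal" where
  "hausdorff_weight k U =
     (if U = {} then 0 else ennreal (unit_ball_vol (real k) * (diameter U / 2) ^ k))"

definition hausdorff_content :: "nat \<Rightarrow> real \<Rightarrow> 'a::metric_space set \<Rightarrow> ennreal" where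
  "hausdorff_content k \<delta> A =
     (INF U \<in> {U :: nat \<Rightarrow> 'a set. A \<subseteq> (\<Union>i. U i) \<and> (\<forall>i. bounded (U i) \<and> diameter (U i) \<le> \<delta>)}.
        \<Sum>i. hausdorff_weight k (U i))"

definition hausdorff_outer :: "nat \<Rightarrow> 'a::metric_space set \<Rightarrow> ennreal" where
  "hausdorff_outer k A = (SUP \<delta>\<in>{0<..}. hausdorff_content k \<delta> A)"

definition hausdorff_measure :: "nat \<Rightarrow> 'a::metric_space measure" where
  "hausdorff_measure k = measure_of UNIV (sets borel) (hausdorff_outer k)"

definition natural_measure :: "nat \<Rightarrow> 'a::euclidean_space set \<Rightarrow> 'a measure" where
  "natural_measure k M = restrict_space (hausdorff_measure k) M"

subsection \<open>The Hausdorff outer measure is a measure on the Borel sets\<close>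

lemma hausdorff_content_antimono_radius:
  assumes "\<delta> \<le> \<delta>'"
  shows "hausdorff_content k \<delta>' A \<le> hausdorff_content k \<delta> A"
  unfolding hausdorff_content_def
  using assms by (intro INF_superset_mono) (auto intro: order_trans)

lemma hausdorff_content_mono: "A \<subseteq> B \<Longrightarrow> hausdorff_content k \<delta> A \<le> hausdorff_content k \<delta> B"
  unfolding hausdorff_content_def
  by (intro INF_superset_mono) auto

lemma hausdorff_content_le_outer:
  "\<delta> > 0 \<Longrightarrow> hausdorff_content k \<delta> A \<le> hausdorff_outer k A"
  unfolding hausdorff_outer_def by (rule SUP_upper) simp

lemma hausdorff_outer_mono: "A \<subseteq> B \<Longrightarrow> hausdorff_outer k A \<le> hausdorff_outer k B"
  unfolding hausdorff_outer_def by (intro SUP_mono) (auto intro!: hausdorff_content_mono)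

lemma hausdorff_outer_empty [simp]: "hausdorff_outer k {} = 0"
proof -
  have "hausdorff_content k \<delta> ({} :: 'a::metric_space set) \<le> 0" if "\<delta> > 0" for \<delta>
    unfolding hausdorff_content_def
    by (rule INF_lower2[of "\<lambda>_. {}"]) (use that in \<open>auto simp: hausdorff_weight_def\<close>)
  then show ?thesis
    unfolding hausdorff_outer_def by (intro antisym SUP_least) auto
qed

lemma hausdorff_content_subadditive:
  fixes A :: "nat \<Rightarrow> 'a::metric_space set"
  shows "hausdorff_content k \<delta> (\<Union>n. A n) \<le> (\<Sum>n. hausdorff_content k \<delta> (A n))"
proof (rule ennreal_le_epsilon)
  let ?H = "hausdorff_content k \<delta> :: 'a set \<Rightarrow> ennreal"
  fix e :: real assume e: "0 < e" "(\<Sum>n. ?H (A n)) < top"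
  then have *: "\<And>n. ?H (A n) < ?H (A n) + e * (1/2)^Suc n"
    by (auto simp add: less_top dest!: ennreal_suminf_lessD)
  have "\<exists>B. A n \<subseteq> (\<Union>i. B i) \<and> (\<forall>i. bounded (B i) \<and> diameter (B i) \<le> \<delta>) \<and>
      (\<Sum>i. hausdorff_weight k (B i)) \<le> ?H (A n) + e * (1/2)^Suc n" for n
    using *[of n] unfolding hausdorff_content_def[of k \<delta> "A n"] INF_less_iff
    by (force intro: less_imp_le)
  then obtain B where B: "\<And>n. A n \<subseteq> (\<Union>i. B n i)"
      "\<And>n i. bounded (B n i) \<and> diameter (B n i) \<le> \<delta>"
      "\<And>n. (\<Sum>i. hausdorff_weight k (B n i)) \<le> ?H (A n) + e * (1/2)^Suc n"
    by metis
  define C where "C = case_prod B o prod_decode"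
  have A_C: "(\<Union>i. A i) \<subseteq> (\<Union>i. C i)"
    using B(1) by (auto simp add: C_def subset_eq) (metis prod.case prod_encode_inverse)
  have C: "bounded (C i) \<and> diameter (C i) \<le> \<delta>" for i
    using B(2) by (auto simp: C_def split_def)
  have "?H (\<Union>i. A i) \<le> (\<Sum>i. hausdorff_weight k (C i))"
    unfolding hausdorff_content_def using A_C C by (intro INF_lower) auto
  also have "\<dots> = (\<Sum>n. \<Sum>i. hausdorff_weight k (B n i))"
    unfolding C_def comp_def
    by (rule suminf_ennreal_2dimen[where f = "\<lambda>p. hausdorff_weight k (case_prod B p)"]) simp
  also have "\<dots> \<le> (\<Sum>n. ?H (A n) + e * (1/2) ^ Suc n)"
    by (intro suminf_le B(3)) auto
  also have "... = (\<Sum>n. ?H (A n)) + (\<Sum>n. ennreal e * ennreal ((1/2) ^ Suc n))"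
    using \<open>0 < e\<close> by (subst suminf_add[symmetric])
                     (auto simp del: ennreal_suminf_cmult simp add: ennreal_mult[symmetric])
  also have "\<dots> = (\<Sum>n. ?H (A n)) + e"
    unfolding ennreal_suminf_cmult
    by (subst suminf_ennreal_eq[OF zero_le_power power_half_series]) auto
  finally show "?H (\<Union>i. A i) \<le> (\<Sum>n. ?H (A n)) + e" .
qed

lemma hausdorff_outer_subadditive:
  "hausdorff_outer k (\<Union>n. A n) \<le> (\<Sum>n. hausdorff_outer k (A n))"
  unfolding hausdorff_outer_def[of k "\<Union>n. A n"]
proof (rule SUP_least)
  fix \<delta> :: real assume "\<delta> \<in> {0<..}"
  then show "hausdorff_content k \<delta> (\<Union>n. A n) \<le> (\<Sum>n. hausdorff_outer k (A n))"
    by (intro order_trans[OF hausdorff_content_subadditive] suminf_le hausdorff_content_le_outer)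
      auto
qed

lemma hausdorff_outer_Un:
  "hausdorff_outer k (A \<union> B) \<le> hausdorff_outer k A + hausdorff_outer k B"
proof -
  have "(\<Union>n. binaryset A B n) = A \<union> B"
    by (rule UN_binaryset_eq)
  moreover have "(\<Sum>n. hausdorff_outer k (binaryset A B n)) = hausdorff_outer k A + hausdorff_outer k B"
    by (rule suminf_binaryset_eq) simp
  ultimately show ?thesis
    using hausdorff_outer_subadditive[of k "binaryset A B"] by simp
qed

lemma hausdorff_outer_separated:
  fixes A B :: "'a::metric_space set"
  assumes e: "e > 0" and sep: "\<And>a b. a \<in> A \<Longrightarrow> b \<in> B \<Longrightarrow> e \<le> dist a b"
  shows "hausdorff_outer k A + hausdorff_outer k B \<le> hausdorff_outer k (A \<union> B)"
proof -
  have content: "hausdorff_content k \<delta> A + hausdorff_content k \<delta> B \<le> hausdorff_content k \<delta> (A \<union> B)"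
    if \<delta>: "\<delta> > 0" "\<delta> < e" for \<delta>
    unfolding hausdorff_content_def[of k \<delta> "A \<union> B"]
  proof (rule INF_greatest)
    fix U :: "nat \<Rightarrow> 'a set"
    assume "U \<in> {U. A \<union> B \<subseteq> (\<Union>i. U i) \<and> (\<forall>i. bounded (U i) \<and> diameter (U i) \<le> \<delta>)}"
    then have U: "A \<subseteq> (\<Union>i. U i)" "B \<subseteq> (\<Union>i. U i)" "\<And>i. bounded (U i)" "\<And>i. diameter (U i) \<le> \<delta>"
      by auto
    define UA where "UA i = (if U i \<inter> A = {} then {} else U i)" for i
    define UB where "UB i = (if U i \<inter> B = {} then {} else U i)" for i
    have "U i \<inter> A = {} \<or> U i \<inter> B = {}" for i
    proof (rule ccontr)
      assume "\<not> ?thesis"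
      then obtain a b where ab: "a \<in> U i" "a \<in> A" "b \<in> U i" "b \<in> B" by auto
      then have "dist a b \<le> \<delta>"
        using diameter_bounded_bound[OF U(3)] U(4) order_trans by blast
      with sep[OF ab(2,4)] \<delta> show False by simp
    qed
    then have le: "hausdorff_weight k (UA i) + hausdorff_weight k (UB i) \<le> hausdorff_weight k (U i)" for i
      by (auto simp: UA_def UB_def hausdorff_weight_def)
    have "hausdorff_content k \<delta> A \<le> (\<Sum>i. hausdorff_weight k (UA i))"
      unfolding hausdorff_content_def using U \<delta>
      by (intro INF_lower) (fastforce simp: UA_def)
    moreover have "hausdorff_content k \<delta> B \<le> (\<Sum>i. hausdorff_weight k (UB i))"
      unfolding hausdorff_content_def using U \<delta>
      by (intro INF_lower) (fastforce simp: UB_def)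
    ultimately have "hausdorff_content k \<delta> A + hausdorff_content k \<delta> B
        \<le> (\<Sum>i. hausdorff_weight k (UA i)) + (\<Sum>i. hausdorff_weight k (UB i))"
      by (rule add_mono)
    also have "\<dots> = (\<Sum>i. hausdorff_weight k (UA i) + hausdorff_weight k (UB i))"
      by (rule suminf_add) auto
    also have "\<dots> \<le> (\<Sum>i. hausdorff_weight k (U i))"
      by (intro suminf_le le) auto
    finally show "hausdorff_content k \<delta> A + hausdorff_content k \<delta> B \<le> (\<Sum>i. hausdorff_weight k (U i))" .
  qed
  have *: "hausdorff_content k \<delta>1 A + hausdorff_content k \<delta>2 B \<le> hausdorff_outer k (A \<union> B)"
    if "\<delta>1 > 0" "\<delta>2 > 0" for \<delta>1 \<delta>2
  proof -
    define \<delta> where "\<delta> = min (min \<delta>1 \<delta>2) (e / 2)"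
    have \<delta>: "\<delta> > 0" "\<delta> < e" "\<delta> \<le> \<delta>1" "\<delta> \<le> \<delta>2"
      using that e by (auto simp: \<delta>_def)
    have "hausdorff_content k \<delta>1 A + hausdorff_content k \<delta>2 B
        \<le> hausdorff_content k \<delta> A + hausdorff_content k \<delta> B"
      using \<delta> by (intro add_mono hausdorff_content_antimono_radius)
    also have "\<dots> \<le> hausdorff_outer k (A \<union> B)"
      using content[OF \<delta>(1,2)] hausdorff_content_le_outer[OF \<delta>(1)] by (rule order_trans)
    finally show ?thesis .
  qed
  have ne: "{0<..} \<noteq> ({} :: real set)" by (meson greaterThan_non_empty)
  have "hausdorff_outer k A + hausdorff_content k \<delta>2 B \<le> hausdorff_outer k (A \<union> B)"
    if "\<delta>2 > 0" for \<delta>2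
    unfolding hausdorff_outer_def[of k A]
    using * that by (subst ennreal_SUP_add_left[symmetric]) (auto simp: ne intro!: SUP_least)
  then show ?thesis
    unfolding hausdorff_outer_def[of k B]
    by (subst add.commute, subst ennreal_SUP_add_left[symmetric])
      (auto simp: ne add.commute intro!: SUP_least)
qed

lemma hausdorff_outer_closed_split:
  fixes C X :: "'a::metric_space set"
  assumes C: "closed C"
  shows "hausdorff_outer k (X \<inter> C) + hausdorff_outer k (X - C) \<le> hausdorff_outer k X"
proof (cases "C = {} \<or> hausdorff_outer k X = top")
  case True
  then show ?thesis by auto
next
  case False
  then have Cne: "C \<noteq> {}" and fin: "hausdorff_outer k X < top"
    by (auto simp: less_top)
  let ?H = "hausdorff_outer k :: 'a set \<Rightarrow> ennreal"
  define r where "r n = 1 / real (Suc n)" for n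
  define B where "B n = {x \<in> X. r n \<le> infdist x C}" for n
  define D where "D n = B (Suc n) - B n" for n
  have r: "r n > 0" "r (Suc n) < r n" for n
    by (auto simp: r_def field_simps)
  have r_mono: "r n \<le> r m" if "m \<le> n" for m n
    using that by (auto simp: r_def field_simps)
  have B_mono: "B m \<subseteq> B n" if "m \<le> n" for m n
    using r_mono[OF that] by (auto simp: B_def)
  have sep: "r m - r n \<le> dist a b" if "a \<in> B m" "infdist b C < r n" for a b m n
  proof -
    have "infdist a C \<le> infdist b C + dist a b"
      by (rule infdist_triangle)
    with that show ?thesis by (auto simp: B_def)
  qed
  have union: "X - C \<subseteq> B n \<union> (\<Union>i. D (i + n))" for n
  proof
    fix x assume x: "x \<in> X - C"
    then have "infdist x C > 0"
      using C Cne by (metis DiffD2 in_closed_iff_infdist_zero infdist_nonneg less_eq_real_def)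
    then obtain m where "r m < infdist x C"
      unfolding r_def using reals_Archimedean[of "infdist x C"] by (auto simp: inverse_eq_divide)
    then have ex: "x \<in> B m" using x by (auto simp: B_def)
    define l where "l = (LEAST m. x \<in> B m)"
    have l: "x \<in> B l" unfolding l_def by (rule LeastI[of "\<lambda>m. x \<in> B m", OF ex])
    show "x \<in> B n \<union> (\<Union>i. D (i + n))"
    proof (cases "l \<le> n")
      case True
      then show ?thesis using l B_mono by blast
    next
      case False
      then obtain j where j: "l = Suc (j + n)"
        by (metis add.commute less_imp_Suc_add linorder_not_le)
      have "x \<notin> B (j + n)"
        using not_less_Least[of "j + n" "\<lambda>m. x \<in> B m"] j by (auto simp: l_def[symmetric])
      with l j have "x \<in> D (j + n)" by (auto simp: D_def)
      then show ?thesis by blast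
    qed
  qed
  define f where "f i = ?H (D (Suc i))" for i
  have step: "?H (B n) + f n \<le> ?H (B (n + 2))" for n
  proof -
    have "?H (B n) + ?H (D (Suc n)) \<le> ?H (B n \<union> D (Suc n))"
    proof (rule hausdorff_outer_separated)
      show "r n - r (Suc n) > 0" using r by simp
    next
      fix a b assume "a \<in> B n" "b \<in> D (Suc n)"
      then show "r n - r (Suc n) \<le> dist a b"
        by (intro sep) (auto simp: D_def B_def)
    qed
    also have "\<dots> \<le> ?H (B (n + 2))"
      using B_mono[of n "n + 2"] by (intro hausdorff_outer_mono) (auto simp: D_def)
    finally show ?thesis by (simp add: f_def)
  qed
  have "(\<Sum>i<2 * m. f i) \<le> ?H (B (2 * m)) + ?H (B (2 * m + 1))" for m
  proof (induction m)
    case 0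
    then show ?case by simp
  next
    case (Suc m)
    have "(\<Sum>i<2 * Suc m. f i) = (\<Sum>i<2 * m. f i) + f (2 * m) + f (2 * m + 1)"
      by (simp add: numeral_2_eq_2)
    also have "\<dots> \<le> (?H (B (2 * m)) + ?H (B (2 * m + 1))) + f (2 * m) + f (2 * m + 1)"
      by (intro add_mono Suc.IH order_refl)
    also have "\<dots> = (?H (B (2 * m)) + f (2 * m)) + (?H (B (2 * m + 1)) + f (2 * m + 1))"
      by (simp add: ac_simps)
    also have "\<dots> \<le> ?H (B (2 * m + 2)) + ?H (B (2 * m + 1 + 2))"
      by (intro add_mono step)
    finally show ?case by simp
  qed
  moreover have BX: "?H (B n) \<le> ?H X" for n
    by (intro hausdorff_outer_mono) (auto simp: B_def)
  ultimately have "(\<Sum>i<2 * m. f i) \<le> ?H X + ?H X" for m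
    by (meson add_mono order_trans)
  moreover have "(\<Sum>i<m. f i) \<le> (\<Sum>i<2 * m. f i)" for m
    by (intro sum_mono2) auto
  ultimately have "(\<Sum>i. f i) \<le> ?H X + ?H X"
    by (intro suminf_le_const) (auto intro: order_trans)
  then have finf: "(\<Sum>i. f i) < top"
    using fin by (metis ennreal_add_less_top le_less_trans)
  let ?a = "?H (X \<inter> C) + ?H (X - C)"
  have "?a + (\<Sum>i<n. f i) \<le> ?H X + (\<Sum>i. f i)" for n
  proof -
    have "?H (X - C) \<le> ?H (B (Suc n) \<union> (\<Union>i. D (i + Suc n)))"
      by (intro hausdorff_outer_mono union)
    also have "\<dots> \<le> ?H (B (Suc n)) + (\<Sum>i. f (i + n))"
      using hausdorff_outer_subadditive[of k "\<lambda>i. D (i + Suc n)"]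
      by (intro order_trans[OF hausdorff_outer_Un] add_left_mono) (simp add: f_def)
    finally have "?a \<le> (?H (X \<inter> C) + ?H (B (Suc n))) + (\<Sum>i. f (i + n))"
      by (simp add: add_left_mono add.assoc)
    also have "?H (X \<inter> C) + ?H (B (Suc n)) \<le> ?H ((X \<inter> C) \<union> B (Suc n))"
    proof (rule hausdorff_outer_separated[OF r(1)[of "Suc n"]])
      fix a b assume "a \<in> X \<inter> C" "b \<in> B (Suc n)"
      then show "r (Suc n) \<le> dist a b"
        using infdist_le[of a C b] by (auto simp: B_def dist_commute)
    qed
    also have "\<dots> \<le> ?H X"
      by (intro hausdorff_outer_mono) (auto simp: B_def)
    finally have "?a \<le> ?H X + (\<Sum>i. f (i + n))"
      by (simp add: add_right_mono)
    then have "?a + (\<Sum>i<n. f i) \<le> ?H X + ((\<Sum>i. f (i + n)) + (\<Sum>i<n. f i))"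
      by (metis add.assoc add_right_mono)
    also have "(\<Sum>i. f (i + n)) + (\<Sum>i<n. f i) = (\<Sum>i. f i)"
      by (rule suminf_offset[symmetric]) simp
    finally show ?thesis .
  qed
  moreover have "(\<lambda>n. ?a + (\<Sum>i<n. f i)) \<longlonglongrightarrow> ?a + (\<Sum>i. f i)"
    by (intro tendsto_add tendsto_const summable_LIMSEQ) simp
  ultimately have "?a + (\<Sum>i. f i) \<le> ?H X + (\<Sum>i. f i)"
    by (intro LIMSEQ_le_const2) auto
  then show ?thesis
    using finf by (auto simp: ennreal_add_left_cancel_le add.commute[of _ "\<Sum>i. f i"])
qed

lemma emeasure_hausdorff_measure:
  fixes A :: "'a::metric_space set"
  assumes "A \<in> sets borel"
  shows "emeasure (hausdorff_measure k) A = hausdorff_outer k A"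
proof -
  let ?H = "hausdorff_outer k :: 'a set \<Rightarrow> ennreal"
  let ?L = "lambda_system UNIV (Pow UNIV) ?H"
  interpret P: sigma_algebra UNIV "Pow UNIV :: 'a set set" by (rule sigma_algebra_Pow)
  have "outer_measure_space (Pow UNIV) ?H"
    by (auto simp: outer_measure_space_def positive_def increasing_def countably_subadditive_def
        intro!: hausdorff_outer_mono hausdorff_outer_subadditive)
  then have ms: "measure_space UNIV ?L ?H"
    by (rule P.caratheodory_lemma)
  then interpret L: sigma_algebra UNIV ?L
    by (simp add: measure_space_def)
  have "C \<in> ?L" if "closed C" for C
    unfolding P.lambda_system_eq
  proof (clarsimp, rule antisym)
    fix X
    show "?H (X \<inter> C) + ?H (X - C) \<le> ?H X"
      by (rule hausdorff_outer_closed_split[OF that])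
    show "?H X \<le> ?H (X \<inter> C) + ?H (X - C)"
      using hausdorff_outer_Un[of k "X \<inter> C" "X - C"] by (simp add: Int_Diff_Un)
  qed
  then have "sigma_sets UNIV (Collect closed) \<subseteq> ?L"
    by (intro L.sigma_sets_subset) auto
  then have borel_L: "sets borel \<subseteq> ?L"
    by (simp add: borel_eq_closed)
  have "measure_space UNIV (sets borel) ?H"
    using measure_down[OF ms _ borel_L] sets.sigma_algebra_axioms[of borel] by simp
  then show ?thesis
    unfolding hausdorff_measure_def
    using assms sets.sigma_algebra_axioms[of "borel :: 'a measure"]
    by (intro emeasure_measure_of_sigma) (auto simp: measure_space_def)
qed

lemma sets_hausdorff_measure [simp]: "sets (hausdorff_measure k) = sets borel"
  and space_hausdorff_measure [simp]: "space (hausdorff_measure k) = UNIV"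
  using sets.sigma_sets_eq[of "borel :: 'a::metric_space measure"]
  by (simp_all add: hausdorff_measure_def space_measure_of_conv)

lemma submanifold_borel:
  fixes M :: "'a::euclidean_space set"
  assumes "submanifold k M"
  shows "M \<in> sets borel"
proof -
  define \<U> where "\<U> = {U. open U \<and> M \<inter> U \<in> sets borel}"
  have "M \<subseteq> \<Union>\<U>"
  proof
    fix p assume "p \<in> M"
    with assms obtain U V S and \<Phi> \<Psi> :: "'a \<Rightarrow> 'a" where *:
      "open U" "p \<in> U" "homeomorphism U V \<Phi> \<Psi>" "subspace S" "\<Phi> ` (M \<inter> U) = S \<inter> V"
      unfolding submanifold_def by (elim ballE[of _ _ p] exE conjE) auto
    have "M \<inter> U = U \<inter> \<Phi> -` S"
    proof (intro equalityI subsetI)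
      fix x assume "x \<in> M \<inter> U"
      then have "\<Phi> x \<in> \<Phi> ` (M \<inter> U)" by (rule imageI)
      with \<open>x \<in> M \<inter> U\<close> show "x \<in> U \<inter> \<Phi> -` S"
        unfolding *(5) by simp
    next
      fix x assume x: "x \<in> U \<inter> \<Phi> -` S"
      then have "\<Phi> x \<in> \<Phi> ` (M \<inter> U)"
        unfolding *(5) using homeomorphism_image1[OF *(3)] by auto
      then obtain y where y: "y \<in> M \<inter> U" "\<Phi> x = \<Phi> y" by (rule imageE)
      then have "x = y"
        using x homeomorphism_apply1[OF *(3)] by (metis IntD1 IntD2)
      with y show "x \<in> M \<inter> U" by simp
    qed
    moreover have "closedin (top_of_set U) (U \<inter> \<Phi> -` S)"
      using *(3,4) by (intro continuous_closedin_preimage closed_subspace) (auto simp: homeomorphism_def)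
    ultimately have "M \<inter> U \<in> sets borel"
      using *(1) by (auto simp: closedin_closed)
    with *(1,2) show "p \<in> \<Union>\<U>" by (auto simp: \<U>_def)
  qed
  obtain \<U>' where \<U>': "\<U>' \<subseteq> \<U>" "countable \<U>'" "\<Union>\<U>' = \<Union>\<U>"
    by (rule Lindelof[of \<U>]) (auto simp: \<U>_def)
  have "M = (\<Union>U\<in>\<U>'. M \<inter> U)"
    using \<open>M \<subseteq> \<Union>\<U>\<close> \<U>'(3) by auto
  also have "\<dots> \<in> sets borel"
    using \<U>'(1,2) by (intro sets.countable_UN') (auto simp: \<U>_def)
  finally show ?thesis .
qed

lemma emeasure_natural_measure:
  assumes "submanifold k M" "A \<in> sets borel" "A \<subseteq> M"
  shows "emeasure (natural_measure k M) A = hausdorff_outer k A"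
  unfolding natural_measure_def
  using assms submanifold_borel[OF assms(1)]
  by (subst emeasure_restrict_space) (simp_all add: emeasure_hausdorff_measure)

section \<open>Norms\<close>

definition L1_norm :: "'a measure \<Rightarrow> ('a \<Rightarrow> real) \<Rightarrow> real" where
  "L1_norm N g = (LINT x|N. \<bar>g x\<bar>)"

text \<open>The essential supremum is taken in \<^typ>\<open>ennreal\<close> so that it is \<open>0\<close>, not \<open>-\<infinity>\<close>, on a
  null space.\<close>

definition Linf_norm :: "'a measure \<Rightarrow> ('a \<Rightarrow> real) \<Rightarrow> ereal" where
  "Linf_norm N g = enn2ereal (esssup N (\<lambda>x. ennreal \<bar>g x\<bar>))"

section \<open>Convex analysis with values in \<open>(-\<infinity>, \<infinity>]\<close>\<close>

definition convex_ereal :: "('x::real_vector \<Rightarrow> ereal) \<Rightarrow> bool" where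
  "convex_ereal R \<longleftrightarrow>
     (\<forall>x y. \<forall>t\<in>{0..1}. R ((1 - t) *\<^sub>R x + t *\<^sub>R y) \<le> ereal (1 - t) * R x + ereal t * R y)"

definition lower_semicontinuous :: "('x::topological_space \<Rightarrow> ereal) \<Rightarrow> bool" where
  "lower_semicontinuous R \<longleftrightarrow> (\<forall>x. R x \<le> Liminf (at x) R)"

definition subdifferential ::
    "('x::real_normed_vector \<Rightarrow> ereal) \<Rightarrow> 'x \<Rightarrow> ('x \<Rightarrow>\<^sub>L real) set" where
  "subdifferential R f0 = {l. \<forall>f. R f0 + ereal (blinfun_apply l (f - f0)) \<le> R f}"

definition bregman ::
    "('x::real_normed_vector \<Rightarrow> ereal) \<Rightarrow> ('x \<Rightarrow>\<^sub>L real) \<Rightarrow> 'x \<Rightarrow> 'x \<Rightarrow> ereal" where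
  "bregman R l f f0 = R f - R f0 - ereal (blinfun_apply l (f - f0))"

text \<open>Real powers on \<open>[0, \<infinity>]\<close>, used for positive exponents only.\<close>

definition ereal_powr :: "ereal \<Rightarrow> real \<Rightarrow> ereal" where
  "ereal_powr x p = (if x = \<infinity> then \<infinity> else ereal (real_of_ereal x powr p))"

definition source_psi :: "(real \<Rightarrow> real) \<Rightarrow> real \<Rightarrow> ereal" where
  "source_psi \<phi> \<alpha> = (SUP \<tau>\<in>{0..}. ereal (\<phi> \<tau> - \<tau> / \<alpha>))"

end

theory Submission
  imports Defs
begin

text \<open>Comparing the minimizer with \<open>f\<^sup>\<dagger>\<close> and splitting the data term over \<open>P\<close> and its complement,
  the noise on \<open>P\<close> only costs twice the \<open>L\<^sup>1(P)\<close>-norm of \<open>h = F(f) - g\<^sup>\<dagger>\<close>, however large that noise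
  is. Since \<open>P\<close> has measure at most \<open>\<eta>\<close>, this is controlled by the sup norm of \<open>h\<close>, hence by the
  smoothing property; the choice \<open>\<delta> = 2b\<eta>/(b - 1)\<close> leaves a fraction \<open>1/b\<close> of \<open>\<parallel>h\<parallel>\<^sub>1\<close> on the good
  side. The source condition and Young's inequality then absorb the Bregman distance.\<close>

text \<open>The inequality already holds pointwise. On \<open>P\<close> the triangle inequality
  gives |\<xi>| - |h - \<xi>| \<le> |h| = 2|h| - |h|, with no trace of \<xi>; off \<open>P\<close>
  the bound |h| \<le> |h - \<xi>| + |\<xi>| gives |\<xi>| - |h - \<xi>| \<le> 2|\<xi>| -
  |h|.\<close>

lemma L1_norm_diff_le_split:
  fixes h \<xi> :: "'a \<Rightarrow> real"
  assumes [measurable]: "integrable N h" "integrable N \<xi>" "P \<in> sets N"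
  shows "L1_norm N \<xi> - L1_norm N (\<lambda>x. h x - \<xi> x)
    \<le> 2 * (LINT x:space N - P|N. \<bar>\<xi> x\<bar>) + 2 * (LINT x:P|N. \<bar>h x\<bar>) - L1_norm N h"
proof -
  have int: "integrable N (\<lambda>x. indicat_real P x * \<bar>h x\<bar>)"
    "integrable N (\<lambda>x. indicat_real (space N - P) x * \<bar>\<xi> x\<bar>)"
    using assms by (auto intro!: integrable_real_mult_indicator simp: mult.commute[of "indicator _ _"])
  have "(LINT x|N. \<bar>\<xi> x\<bar> - \<bar>h x - \<xi> x\<bar>)
      \<le> (LINT x|N. 2 * (indicator (space N - P) x * \<bar>\<xi> x\<bar>) + 2 * (indicator P x * \<bar>h x\<bar>) - \<bar>h x\<bar>)"
    using assms int by (intro integral_mono) (auto simp: indicator_def)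
  then show ?thesis
    using assms int by (simp add: L1_norm_def set_lebesgue_integral_def)
qed

lemma set_integral_le_Linf_norm:
  fixes h :: "'a \<Rightarrow> real"
  assumes h: "integrable N h" and P: "P \<in> sets N" "emeasure N P \<le> ennreal \<eta>"
    and "\<eta> \<ge> 0" "B \<ge> 0" and B: "Linf_norm N h \<le> ereal B"
  shows "(LINT x:P|N. \<bar>h x\<bar>) \<le> \<eta> * B"
proof -
  have [measurable]: "h \<in> borel_measurable N" using h by simp
  have le: "esssup N (\<lambda>x. ennreal \<bar>h x\<bar>) \<le> ennreal B"
    using B \<open>B \<ge> 0\<close> unfolding Linf_norm_def
    by (metis enn2ereal_ennreal less_eq_ennreal.rep_eq)
  have "AE x in N. ennreal \<bar>h x\<bar> \<le> esssup N (\<lambda>x. ennreal \<bar>h x\<bar>)"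
    by (rule esssup_AE)
  then have AE: "AE x in N. \<bar>h x\<bar> \<le> B"
  proof eventually_elim
    case (elim x)
    then have "ennreal \<bar>h x\<bar> \<le> ennreal B"
      using le by (rule order_trans)
    then show ?case
      using \<open>B \<ge> 0\<close> by simp
  qed
  \<comment> \<open>The whole space may have infinite measure; finiteness on \<open>P\<close> is
    what makes the constant \<open>B\<close> integrable there.\<close>
  have fin: "emeasure N P < \<infinity>" using P(2) by (metis ennreal_less_top infinity_ennreal_def le_less_trans)
  have "(LINT x:P|N. \<bar>h x\<bar>) \<le> (LINT x:P|N. B)"
    unfolding set_lebesgue_integral_def
  proof (rule integral_mono_AE)
    show "integrable N (\<lambda>x. indicat_real P x *\<^sub>R \<bar>h x\<bar>)"
      using h P by (intro integrable_mult_indicator) auto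
    show "integrable N (\<lambda>x. indicat_real P x *\<^sub>R B)"
      using P fin by (auto intro!: integrable_mult_left)
    show "AE x in N. indicat_real P x *\<^sub>R \<bar>h x\<bar> \<le> indicat_real P x *\<^sub>R B"
      using AE by eventually_elim (auto simp: indicator_def)
  qed
  also have "\<dots> = measure N P * B"
    using P fin by (simp add: set_lebesgue_integral_def)
  also have "\<dots> \<le> \<eta> * B"
    using P \<open>\<eta> \<ge> 0\<close> \<open>B \<ge> 0\<close> by (intro mult_right_mono) (auto simp: measure_def enn2real_leI)
  finally show ?thesis .
qed

lemma conjugate_exponent_gt_1:
  fixes q q' :: real
  assumes "q > 1" "1 / q + 1 / q' = 1"
  shows "q' > 1"
  using assms by (smt (verit) divide_nonneg_nonpos divide_less_eq_1 less_divide_eq_1 zero_less_divide_iff)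

text \<open>Young's inequality is applied to the factors (\<beta> d)^(1/q) and \<beta>^(-1/q) c.
  This weighting makes the d-term equal to \<beta> d / q, a fraction 1/q < 1 of \<beta> d, so that
  it can be absorbed later; the price is the power \<beta>^(-q'/q) = \<beta>^(1 - q').\<close>

lemma Youngs_inequality_scaled:
  fixes q q' \<beta> c d :: real
  assumes "\<beta> > 0" "q > 1" "1 / q + 1 / q' = 1" "c \<ge> 0" "d \<ge> 0"
  shows "c * d powr (1 / q) \<le> \<beta> * d / q + \<beta> powr (1 - q') * c powr q' / q'"
proof -
  have q': "q' > 1"
    using assms(2,3) by (rule conjugate_exponent_gt_1)
  have "1 / q = 1 - 1 / q'"
    using assms(3) by simp
  then have "- q' * (1 / q) = 1 - q'"
    using q' by (simp add: field_simps)
  then have e: "- q' / q = 1 - q'"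
    by simp
  have "c * d powr (1 / q) = (\<beta> * d) powr (1 / q) * (\<beta> powr (- 1 / q) * c)"
    using assms by (simp add: powr_mult powr_minus field_simps)
  also have "\<dots> \<le> ((\<beta> * d) powr (1 / q)) powr q / q + (\<beta> powr (- 1 / q) * c) powr q' / q'"
    using assms q' by (intro Youngs_inequality) auto
  also have "((\<beta> * d) powr (1 / q)) powr q = \<beta> * d"
    using assms by (simp add: powr_powr)
  also have "(\<beta> powr (- 1 / q) * c) powr q' = \<beta> powr (1 - q') * c powr q'"
    using assms e by (simp add: powr_mult powr_powr)
  finally show ?thesis .
qed

lemma source_psi_ge: "\<tau> \<ge> 0 \<Longrightarrow> ereal (\<phi> \<tau> - \<tau> / \<alpha>) \<le> source_psi \<phi> \<alpha>"
  unfolding source_psi_def by (rule SUP_upper) simp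

text \<open>The real arithmetic common to both rates: \<open>d\<close> is the Bregman distance,
  \<open>L\<close> the residual norm, \<open>s\<close> stands for \<phi>(L), \<open>c\<close> for 2
  \<eta> \<gamma>(\<delta>), and \<open>u\<close>, \<open>v\<close> for \<psi>(b \<alpha>), \<psi>(2
  b \<alpha>). The two bounds differ in how they spend the negative term -L / (b \<alpha>): the
  first uses all of it to turn \<open>s\<close> into \<open>u\<close>, the second only half.\<close>

lemma absorb_bregman:
  fixes q q' \<alpha> \<beta> b c d s \<epsilon> L u v :: real
  assumes "\<beta> > 0" "q > 1" "1 / q + 1 / q' = 1" "\<alpha> > 0" "b > 1" "c \<ge> 0" "d \<ge> 0"
    and main: "\<beta> * d \<le> s + (2 * \<epsilon> + c * d powr (1 / q) - L / b) / \<alpha>"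
    and u: "s - L / (b * \<alpha>) \<le> u"
    and v: "s - L / (2 * b * \<alpha>) \<le> v" "v \<ge> 0" and "\<epsilon> \<ge> 0"
  shows "\<beta> * d \<le> 2 * q' / \<alpha> * \<epsilon> + \<beta> powr (1 - q') * (c / \<alpha>) powr q' + q' * u"
    and "1 / b * L \<le> 4 * q' * \<epsilon> + 2 * (c powr q' / (\<beta> * \<alpha>) powr (q' - 1)) + 2 * \<alpha> * q' * v"
proof -
  have q': "q' > 1"
    using assms(2,3) by (rule conjugate_exponent_gt_1)
  define Y where "Y = \<beta> powr (1 - q') * (c / \<alpha>) powr q'"
  have Y: "Y \<ge> 0" by (simp add: Y_def)
  have "c / \<alpha> * d powr (1 / q) \<le> \<beta> * d / q + Y / q'"
    unfolding Y_def using assms by (intro Youngs_inequality_scaled) auto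
  moreover have "(2 * \<epsilon> + c * d powr (1 / q) - L / b) / \<alpha>
      = 2 * \<epsilon> / \<alpha> + c / \<alpha> * d powr (1 / q) - L / (b * \<alpha>)"
    using assms by (simp add: field_simps)
  ultimately have *: "\<beta> * d \<le> s + 2 * \<epsilon> / \<alpha> + \<beta> * d / q + Y / q' - L / (b * \<alpha>)"
    using main by linarith
  \<comment> \<open>By conjugacy, absorbing \<beta> d / q leaves \<beta> d / q' on the left;
    multiplying by q' then produces the factors q' on the right.\<close>
  have "\<beta> * d / q = \<beta> * d - \<beta> * d / q'"
    using assms(3) by (metis add_diff_cancel_right' mult.right_neutral right_diff_distrib times_divide_eq_right)
  with * u have "\<beta> * d / q' \<le> 2 * \<epsilon> / \<alpha> + Y / q' + u"
    by linarith
  then have "\<beta> * d \<le> (2 * \<epsilon> / \<alpha> + Y / q' + u) * q'"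
    using q' by (simp add: pos_divide_le_eq)
  also have "\<dots> = 2 * q' / \<alpha> * \<epsilon> + Y + q' * u"
    using q' by (simp add: field_simps)
  finally show "\<beta> * d \<le> 2 * q' / \<alpha> * \<epsilon> + \<beta> powr (1 - q') * (c / \<alpha>) powr q' + q' * u"
    by (simp add: Y_def)
  \<comment> \<open>For the residual bound the Bregman terms cancel from both sides. One half of L /
    (b \<alpha>) moves to the left, the other half turns \<open>s\<close> into
    \<open>v\<close>.\<close>
  have "\<beta> * d / q \<le> \<beta> * d"
    using assms by (simp add: divide_le_eq mult_le_cancel_left1 not_less)
  moreover have "L / (b * \<alpha>) = L / (2 * b * \<alpha>) + L / (2 * b * \<alpha>)"
    using assms by (simp add: field_simps)
  moreover have "Y / q' \<le> Y"
    using q' Y by (simp add: divide_le_eq mult_le_cancel_left1)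
  ultimately have "L / (2 * b * \<alpha>) \<le> 2 * \<epsilon> / \<alpha> + Y + v"
    using * v by linarith
  then have "2 * \<alpha> * (L / (2 * b * \<alpha>)) \<le> 2 * \<alpha> * (2 * \<epsilon> / \<alpha> + Y + v)"
    using assms by (intro mult_left_mono) auto
  moreover have "2 * \<alpha> * (L / (2 * b * \<alpha>)) = 1 / b * L"
    using assms by (simp add: field_simps)
  moreover have "2 * \<alpha> * (2 * \<epsilon> / \<alpha> + Y + v) = 4 * \<epsilon> + 2 * (\<alpha> * Y) + 2 * \<alpha> * v"
    using assms by (simp add: field_simps)
  moreover have "\<alpha> * Y = c powr q' / (\<beta> * \<alpha>) powr (q' - 1)"
    using assms by (simp add: Y_def powr_divide powr_mult powr_diff field_simps)
  \<comment> \<open>The argument yields the constants 4 and 2 \<alpha>; they are enlarged by q' > 1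
    to match the stated form, using \<open>v\<close> \<ge> 0.\<close>
  moreover have "4 * \<epsilon> \<le> 4 * q' * \<epsilon>" "2 * \<alpha> * v \<le> 2 * \<alpha> * q' * v"
    using q' assms by (simp_all add: mult_le_cancel_right1 mult_right_mono)
  ultimately show "1 / b * L \<le> 4 * q' * \<epsilon> + 2 * (c powr q' / (\<beta> * \<alpha>) powr (q' - 1)) + 2 * \<alpha> * q' * v"
    by linarith
qed

theorem theorem2p4:
  fixes M :: "(real ^ 'd) set" and k :: nat and N :: "(real ^ 'd) measure"
    and F :: "'x::banach \<Rightarrow> real ^ 'd \<Rightarrow> real" and DF :: "'x set"
    and R :: "'x \<Rightarrow> ereal" and fdag :: 'x and gdag :: "real ^ 'd \<Rightarrow> real"
    and fstar :: "'x \<Rightarrow>\<^sub>L real"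
    and \<phi> \<gamma> :: "real \<Rightarrow> real" and \<beta> \<delta>0 q q' :: real
  assumes manifold: "submanifold k M"
    and measure: "N = natural_measure k M"
    and F_L1: "\<forall>f\<in>DF. integrable N (F f)"
    and R_values: "\<forall>f. R f \<noteq> -\<infinity>"
    and R_convex: "convex_ereal R"
    and R_lsc: "lower_semicontinuous R"
    and fdag: "fdag \<in> DF" "R fdag < \<infinity>"
    and gdag: "gdag = F fdag"
    and fstar: "fstar \<in> subdifferential R fdag"
    and beta: "\<beta> > 0"
    and phi: "concave_on {0..} \<phi>" "mono_on {0..} \<phi>" "\<forall>\<tau>\<ge>0. \<phi> \<tau> \<ge> 0" "\<phi> 0 = 0"
    and delta0: "\<delta>0 > 0"
    and q: "q > 1"
    and gamma: "mono_on {0..\<delta>0} \<gamma>" "\<forall>\<delta>\<in>{0..\<delta>0}. \<gamma> \<delta> \<ge> 0" "(\<gamma> \<longlongrightarrow> 0) (at_right 0)"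
    and smoothing: "\<forall>\<delta> f. 0 < \<delta> \<and> \<delta> \<le> \<delta>0 \<and> f \<in> DF \<longrightarrow>
      Linf_norm N (\<lambda>x. F f x - gdag x)
        \<le> ereal (\<gamma> \<delta>) * ereal_powr (bregman R fstar f fdag) (1 / q)
          + ereal (1 / \<delta> * L1_norm N (\<lambda>x. F f x - gdag x))"
    and conjugate: "1 / q + 1 / q' = 1"
  shows "\<forall>b>1. \<exists>\<eta>0>0. \<forall>\<eta> \<epsilon> \<alpha> gobs fhat.
    0 < \<eta> \<and> \<eta> \<le> \<eta>0 \<and> \<epsilon> \<ge> 0 \<and> \<alpha> > 0 \<and> integrable N gobs \<and>
    (\<exists>P\<in>sets N. (LINT x:M - P|N. \<bar>gobs x - gdag x\<bar>) \<le> \<epsilon> \<and> emeasure N P \<le> ennreal \<eta>) \<and>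
    is_arg_min (\<lambda>f. ereal (1 / \<alpha> * L1_norm N (\<lambda>x. F f x - gobs x)) + R f) (\<lambda>f. f \<in> DF) fhat \<and>
    \<comment> \<open>variational source condition, only required at the minimizer\<close>
    ereal \<beta> * bregman R fstar fhat fdag
      \<le> R fhat - R fdag + ereal (\<phi> (L1_norm N (\<lambda>x. F fhat x - F fdag x)))
    \<longrightarrow>
      ereal \<beta> * bregman R fstar fhat fdag
        \<le> ereal (2 * q' / \<alpha> * \<epsilon>
            + \<beta> powr (1 - q') * (2 / \<alpha> * \<eta> * \<gamma> (2 * b / (b - 1) * \<eta>)) powr q')
          + ereal q' * source_psi \<phi> (b * \<alpha>) \<and>
      ereal (1 / b * L1_norm N (\<lambda>x. F fhat x - gdag x))
        \<le> ereal (4 * q' * \<epsilon>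
            + 2 * ((2 * \<eta> * \<gamma> (2 * b / (b - 1) * \<eta>)) powr q' / (\<beta> * \<alpha>) powr (q' - 1)))
          + ereal (2 * \<alpha> * q') * source_psi \<phi> (2 * b * \<alpha>)"
proof (intro allI impI exI conjI; (elim conjE bexE)?)
  fix b :: real assume b: "b > 1"
  \<comment> \<open>This value of \<eta>0 is the largest for which \<delta> = 2 b \<eta> / (b - 1)
    stays below \<open>\<delta>0\<close> for all \<eta> \<le> \<eta>0.\<close>
  show "\<delta>0 * (b - 1) / (2 * b) > 0"
    using b delta0 by simp
  fix \<eta> \<epsilon> \<alpha> gobs fhat P
  assume \<eta>: "0 < \<eta>" "\<eta> \<le> \<delta>0 * (b - 1) / (2 * b)" and \<epsilon>: "\<epsilon> \<ge> 0" and \<alpha>: "\<alpha> > 0"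
    and gobs: "integrable N gobs"
    and P: "P \<in> sets N" "(LINT x:M - P|N. \<bar>gobs x - gdag x\<bar>) \<le> \<epsilon>" "emeasure N P \<le> ennreal \<eta>"
    and argmin: "is_arg_min (\<lambda>f. ereal (1 / \<alpha> * L1_norm N (\<lambda>x. F f x - gobs x)) + R f)
        (\<lambda>f. f \<in> DF) fhat"
    and source: "ereal \<beta> * bregman R fstar fhat fdag
      \<le> R fhat - R fdag + ereal (\<phi> (L1_norm N (\<lambda>x. F fhat x - F fdag x)))"
  have spaceN: "space N = M"
    by (simp add: measure natural_measure_def space_restrict_space)
  have q': "q' > 1"
    using q conjugate by (rule conjugate_exponent_gt_1)
  obtain r0 where r0: "R fdag = ereal r0"
    using fdag(2) R_values by (cases "R fdag") auto
  have fhat: "fhat \<in> DF"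
    using argmin by (simp add: is_arg_min_def)
  define h where "h x = F fhat x - gdag x" for x
  define \<xi> where "\<xi> x = gobs x - gdag x" for x
  define L where "L = L1_norm N h"
  have int: "integrable N h" "integrable N \<xi>"
    using F_L1 fhat fdag(1) gobs by (auto simp: h_def[abs_def] \<xi>_def[abs_def] gdag)
  have L: "L \<ge> 0" by (simp add: L_def L1_norm_def)
  have [simp]: "L1_norm N (\<lambda>x. F fhat x - gobs x) = L1_norm N (\<lambda>x. h x - \<xi> x)"
    "L1_norm N (\<lambda>x. F fdag x - gobs x) = L1_norm N \<xi>"
    by (simp_all add: L1_norm_def h_def \<xi>_def gdag abs_minus_commute)
  have min: "ereal (1 / \<alpha> * L1_norm N (\<lambda>x. h x - \<xi> x)) + R fhat
      \<le> ereal (1 / \<alpha> * L1_norm N \<xi>) + R fdag"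
    using argmin fdag(1) by (auto simp: is_arg_min_def not_less)
  \<comment> \<open>Comparison with \<open>fdag\<close>, whose objective value is finite, excludes
    \<open>R fhat\<close> = \<infinity>. From here on the Bregman distance is a real number.\<close>
  then obtain r where r: "R fhat = ereal r"
    using r0 R_values by (cases "R fhat") auto
  define d where "d = r - r0 - blinfun_apply fstar (fhat - fdag)"
  have bregman: "bregman R fstar fhat fdag = ereal d"
    by (simp add: bregman_def r r0 d_def)
  have "R fdag + ereal (blinfun_apply fstar (fhat - fdag)) \<le> R fhat"
    using fstar by (auto simp: subdifferential_def)
  then have d: "d \<ge> 0"
    by (simp add: r r0 d_def)
  define \<delta> where "\<delta> = 2 * b / (b - 1) * \<eta>"
  have \<delta>: "0 < \<delta>" "\<delta> \<le> \<delta>0" and \<eta>\<delta>: "2 * \<eta> / \<delta> = 1 - 1 / b"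
    using b \<eta> by (auto simp: \<delta>_def field_simps)
  have \<gamma>: "\<gamma> \<delta> \<ge> 0" using gamma(2) \<delta> by simp
  define B where "B = \<gamma> \<delta> * d powr (1 / q) + 1 / \<delta> * L"
  have "Linf_norm N h \<le> ereal B"
    using smoothing[rule_format, of \<delta> fhat] \<delta> fhat
    by (simp add: bregman ereal_powr_def B_def L_def h_def[abs_def])
  moreover have "B \<ge> 0" using \<gamma> L \<delta> by (simp add: B_def)
  ultimately have "(LINT x:P|N. \<bar>h x\<bar>) \<le> \<eta> * B"
    using int P \<eta> by (intro set_integral_le_Linf_norm) auto
  moreover have "2 * (\<eta> * B) = 2 * \<eta> * \<gamma> \<delta> * d powr (1 / q) + (2 * \<eta> / \<delta>) * L"
    by (simp add: B_def algebra_simps)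
  then have "2 * (\<eta> * B) = 2 * \<eta> * \<gamma> \<delta> * d powr (1 / q) + L - L / b"
    unfolding \<eta>\<delta> by (simp add: algebra_simps)
  moreover have "L1_norm N \<xi> - L1_norm N (\<lambda>x. h x - \<xi> x)
      \<le> 2 * (LINT x:M - P|N. \<bar>\<xi> x\<bar>) + 2 * (LINT x:P|N. \<bar>h x\<bar>) - L"
    using L1_norm_diff_le_split[OF int P(1)] by (simp add: spaceN L_def)
  moreover have "(LINT x:M - P|N. \<bar>\<xi> x\<bar>) \<le> \<epsilon>"
    using P(2) by (simp add: \<xi>_def)
  ultimately have "L1_norm N \<xi> - L1_norm N (\<lambda>x. h x - \<xi> x)
      \<le> 2 * \<epsilon> + 2 * \<eta> * \<gamma> \<delta> * d powr (1 / q) - L / b"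
    by linarith
  then have "1 / \<alpha> * L1_norm N \<xi> - 1 / \<alpha> * L1_norm N (\<lambda>x. h x - \<xi> x)
      \<le> (2 * \<epsilon> + 2 * \<eta> * \<gamma> \<delta> * d powr (1 / q) - L / b) / \<alpha>"
    using \<alpha> by (simp add: divide_right_mono flip: diff_divide_distrib)
  moreover have "\<beta> * d \<le> r - r0 + \<phi> L"
    using source by (simp add: bregman r r0 L_def h_def[abs_def] gdag)
  \<comment> \<open>The source condition leaves the difference \<open>r - r0\<close>, which
    minimality bounds by the difference of the two data terms divided by \<alpha>.\<close>
  ultimately have main: "\<beta> * d \<le> \<phi> L + (2 * \<epsilon> + 2 * \<eta> * \<gamma> \<delta> * d powr (1 / q) - L / b) / \<alpha>"
    using min by (simp add: r r0)
  have c: "2 * \<eta> * \<gamma> \<delta> \<ge> 0" using \<eta> \<gamma> by simp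
  note absorb = absorb_bregman[OF beta q conjugate \<alpha> b c d main _ _ _ \<epsilon>]
  \<comment> \<open>Take \<tau> = 0 in the supremum. This rules out the value -\<infinity> in the
    case distinctions below.\<close>
  have psi0: "0 \<le> source_psi \<phi> a" for a
    using source_psi_ge[of 0 \<phi> a] phi(4) by (simp add: zero_ereal_def)
  show "ereal \<beta> * bregman R fstar fhat fdag
      \<le> ereal (2 * q' / \<alpha> * \<epsilon>
          + \<beta> powr (1 - q') * (2 / \<alpha> * \<eta> * \<gamma> (2 * b / (b - 1) * \<eta>)) powr q')
        + ereal q' * source_psi \<phi> (b * \<alpha>)"
  proof (cases "source_psi \<phi> (b * \<alpha>)")
    case (real u)
    have "\<phi> L - L / (b * \<alpha>) \<le> u"
      using source_psi_ge[OF L, of \<phi> "b * \<alpha>"] by (simp add: real)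
    from absorb(1)[OF this, of "max 0 (\<phi> L - L / (2 * b * \<alpha>))"] show ?thesis
      by (simp add: real bregman \<delta>_def)
  \<comment> \<open>If \<psi> is \<infinity>, the right-hand side is \<infinity> because q' >
    0.\<close>
  qed (use psi0[of "b * \<alpha>"] q' in \<open>simp_all add: bregman\<close>)
  show "ereal (1 / b * L1_norm N (\<lambda>x. F fhat x - gdag x))
      \<le> ereal (4 * q' * \<epsilon>
          + 2 * ((2 * \<eta> * \<gamma> (2 * b / (b - 1) * \<eta>)) powr q' / (\<beta> * \<alpha>) powr (q' - 1)))
        + ereal (2 * \<alpha> * q') * source_psi \<phi> (2 * b * \<alpha>)"
  proof (cases "source_psi \<phi> (2 * b * \<alpha>)")
    case (real v)
    have "\<phi> L - L / (2 * b * \<alpha>) \<le> v"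
      using source_psi_ge[OF L, of \<phi> "2 * b * \<alpha>"] by (simp add: real)
    from absorb(2)[OF order_refl this] psi0[of "2 * b * \<alpha>"] show ?thesis
      by (simp add: real L_def h_def[abs_def] \<delta>_def)
  qed (use psi0[of "2 * b * \<alpha>"] q' \<alpha> in simp_all)
qed

end
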